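(* Let $F=(F_1,\ldots,F_n)$ be a tuple of real polynomials in $x\in\mathbb{R}^n$ and let $X=\{x\in\mathbb{R}^n: g_i(x)\ge 0\ (i\in\mathcal{I}),\ g_i(x)=0\ (i\in\mathcal{E})\}$, where $g=(g_1,\ldots,g_m)$ is a nonsingular tuple of real polynomials. If $|\mathcal{K}|<\infty$, then all solutions of $\mathrm{VI}(X,F)$ can be obtained by running Algorithm B finitely many times (according to the scheme described in the context).
   Context: Throughout, $X\subseteq\mathbb{R}^n$ is nonempty and closed; $\mathcal{E}$ and $\mathcal{I}$ are disjoint index sets with $\mathcal{E}\cup\mathcal{I}=[m]=\{1,\ldots,m\}$. $\mathrm{VI}(X,F)$ is the problem of finding $x\in X$ such that $(y-x)^TF(x)\ge 0$ for all $y\in X$; its solution set is $\mathrm{SOL}(X,F)$. $[x]_1:=(1,x_1,\ldots,x_n)^T$. A property holds generically if it holds for all points of the space of input data except a set of Lebesgue measure zero. Let $G(x)$ be the $(n+m)\times m$ polynomial matrix whose $i$th column is $\nabla g_i(x)$ stacked on top of $g_i(x)e_i$ ($e_i$ the $i$th standard basis vector of $\mathbb{R}^m$). The tuple $g$ is called nonsingular if $G(x)$ has full column rank for every $x\in\mathbb{C}^n$. Equivalently (known result), there is a matrix $L(x)$ of real polynomials with $L(x)G(x)=I_m$. Fix such an $L(x)$, and let $\hat F(x):=(F(x)^T,0,\ldots,0)^T\in\mathbb{R}[x]^{n+m}$, $\lambda(x)=(\lambda_1(x),\ldots,\lambda_m(x)):=L(x)\hat F(x)$. Then $\mathcal{K}$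 is the set of $x\in\mathbb{R}^n$ satisfying $$F(x)=\sum_{i=1}^m\lambda_i(x)\nabla g_i(x),\quad g_i(x)=0\ (i\in\mathcal{E}),\quad \lambda_i(x)\ge0,\ g_i(x)\ge0,\ \lambda_i(x)g_i(x)=0\ (i\in\mathcal{I}).$$ ($\mathcal{K}$ coincides with the set of KKT points of $\mathrm{VI}(X,F)$.) In the algorithms below all subproblems are understood to be solved exactly and globally, and for $u\in\mathbb{R}^n$ we consider the verification problem $$\varepsilon:=\min_{y\in X}\ (y-u)^TF(u).\qquad(\mathrm{Ver}_u)$$ Standing assumption: $(\mathrm{Ver}_u)$ has a minimizer for every $u$ to which it is applied. Algorithm A (finding one solution). Step 0. Choose a generic positive definite matrix $\Theta\in\mathbb{R}^{(n+1)\times(n+1)}$. Set $k:=1$, $V:=\emptyset$. Step 1. Minimize $[x]_1^T\Theta[x]_1$ subject to $x\in\mathcal{K}$ and $(v-x)^TF(x)\ge0$ for all $v\in V$. If infeasible, conclude $\mathrm{SOL}(X,F)=\emptyset$ and stop; otherwise let $u^{(k)}$ be a minimizer. Step 2. Solve $(\mathrm{Ver}_u)$ with $u:=u^{(k)}$ for a nonempty set $T^{(k)}$ of minimizers. Step 3. If $\varepsilon=0$, output $u^{(k)}\in\mathrm{SOL}(X,F)$ and stop; otherwise set $V:=V\cup T^{(k)}$, $k:=k+1$, and go to Step 1. Algorithm B (finding another solution, given a solution $x^*$ already found; $\Theta$ and the current set $V\subseteq X$ are kept from the previous runs). Step 0. Choose $\delta_0>0$ and $0<\rho<1$; set $\delta:=\delta_0$.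 Step 1. Compute $\gamma^*:=\max\,[x]_1^T\Theta[x]_1$ subject to $x\in\mathcal{K}$, $(v-x)^TF(x)\ge0$ $(v\in V)$, $[x]_1^T\Theta[x]_1\le[x^*]_1^T\Theta[x^*]_1+\delta$. Step 2. If $\gamma^*=[x^*]_1^T\Theta[x^*]_1$, go to Step 3; otherwise set $\delta:=\rho\delta$ and go to Step 1. Step 3. Minimize $[x]_1^T\Theta[x]_1$ subject to $x\in\mathcal{K}$, $(v-x)^TF(x)\ge0$ $(v\in V)$, $[x]_1^T\Theta[x]_1\ge[x^*]_1^T\Theta[x^*]_1+\delta$. If infeasible, conclude that there is no other solution and stop; otherwise let $u$ be a minimizer. Step 4. Solve $(\mathrm{Ver}_u)$ for a nonempty set $T$ of minimizers. Step 5. If $\varepsilon=0$, output $u\in\mathrm{SOL}(X,F)$ as another solution and stop; otherwise set $V:=V\cup T$ and go to Step 3. Scheme: Algorithm A is run first; if it returns a solution $x^{(1)}$, Algorithm B is run repeatedly, with $x^*:=x^{(k-1)}$ the most recently found solution, producing $x^{(k)}$ for $k=2,3,\ldots$, until Algorithm B stops at Step 3 with the conclusion that there is no other solution. *)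

theory Defs
  imports "HOL-Analysis.Analysis" "HOL-Library.Poly_Mapping" "HOL-Library.Uprod"
begin

section \<open>Real polynomials in the variables \<open>x $ i\<close>\<close>

text \<open>A polynomial maps exponent vectors to real coefficients; addition and multiplication are
  those of the monoid algebra structure provided by \<^theory>\<open>HOL-Library.Poly_Mapping\<close>.\<close>

type_synonym 'n mpoly = "('n \<Rightarrow>\<^sub>0 nat) \<Rightarrow>\<^sub>0 real"

text \<open>Evaluation at a point with entries in a commutative real algebra; it is used for real and for
  complex points.\<close>

definition mpeval ::
    "'n::finite mpoly \<Rightarrow> 'a::{real_algebra_1, comm_ring_1} ^ 'n \<Rightarrow> 'a" where
  "mpeval p x =
     (\<Sum>\<alpha> \<in> Poly_Mapping.keys p.
        of_real (Poly_Mapping.lookup p \<alpha>) * (\<Prod>i\<in>UNIV. (x $ i) ^ Poly_Mapping.lookup \<alpha> i))"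

text \<open>Formal partial derivative. The exponent subtraction is truncated, but where the
  truncation takes effect the coefficient is zero.\<close>

definition mpderiv :: "'n \<Rightarrow> 'n mpoly \<Rightarrow> 'n mpoly" where
  "mpderiv i p =
     (\<Sum>\<alpha> \<in> Poly_Mapping.keys p.
        Poly_Mapping.single (\<alpha> - Poly_Mapping.single i 1)
          (real (Poly_Mapping.lookup \<alpha> i) * Poly_Mapping.lookup p \<alpha>))"

definition mpgrad :: "'n::finite mpoly \<Rightarrow> 'n mpoly ^ 'n" where
  "mpgrad p = (\<chi> i. mpderiv i p)"

definition mpeval_vec ::
    "'n::finite mpoly ^ 'k \<Rightarrow> 'a::{real_algebra_1, comm_ring_1} ^ 'n \<Rightarrow> 'a ^ 'k" where
  "mpeval_vec P x = (\<chi> k. mpeval (P $ k) x)"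

definition mpeval_mat ::
    "'n::finite mpoly ^ 'k ^ 'l \<Rightarrow> 'a::{real_algebra_1, comm_ring_1} ^ 'n \<Rightarrow> 'a ^ 'k ^ 'l" where
  "mpeval_mat P x = (\<chi> r c. mpeval (P $ r $ c) x)"


section \<open>Variational inequalities\<close>

definition VI_SOL :: "'v::real_inner set \<Rightarrow> ('v \<Rightarrow> 'v) \<Rightarrow> 'v set" where
  "VI_SOL X F = {x \<in> X. \<forall>y\<in>X. (y - x) \<bullet> F x \<ge> 0}"

definition semialg_set ::
    "'m set \<Rightarrow> 'm set \<Rightarrow> 'n::finite mpoly ^ 'm \<Rightarrow> (real ^ 'n) set" where
  "semialg_set \<E> \<I> g =
     {x. (\<forall>i\<in>\<I>. mpeval (g $ i) x \<ge> 0) \<and> (\<forall>i\<in>\<E>. mpeval (g $ i) x = 0)}"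

text \<open>Rows indexed by \<open>'n + 'm\<close>: column \<open>i\<close> is \<open>\<nabla>g\<^sub>i\<close> stacked on top of \<open>g\<^sub>i e\<^sub>i\<close>.\<close>

definition G_mat :: "'n::finite mpoly ^ 'm::finite \<Rightarrow> 'n mpoly ^ 'm ^ ('n + 'm)" where
  "G_mat g = (\<chi> r i. case r of Inl k \<Rightarrow> mpgrad (g $ i) $ k | Inr j \<Rightarrow> if j = i then g $ i else 0)"

definition nonsingular_tuple :: "'n::finite mpoly ^ 'm::finite \<Rightarrow> bool" where
  "nonsingular_tuple g \<longleftrightarrow> (\<forall>z :: complex ^ 'n. rank (mpeval_mat (G_mat g) z) = CARD('m))"

definition F_hat :: "'n::finite mpoly ^ 'n \<Rightarrow> 'n mpoly ^ ('n + 'm::finite)" where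
  "F_hat F = (\<chi> r. case r of Inl k \<Rightarrow> F $ k | Inr j \<Rightarrow> 0)"

definition multiplier ::
    "'n::finite mpoly ^ ('n + 'm::finite) ^ 'm \<Rightarrow> 'n mpoly ^ 'n \<Rightarrow> 'n mpoly ^ 'm" where
  "multiplier L F = L *v F_hat F"

definition KKT_set ::
    "'m::finite set \<Rightarrow> 'm set \<Rightarrow> 'n::finite mpoly ^ 'm \<Rightarrow> 'n mpoly ^ ('n + 'm) ^ 'm \<Rightarrow>
     'n mpoly ^ 'n \<Rightarrow> (real ^ 'n) set" where
  "KKT_set \<E> \<I> g L F =
     {x. mpeval_vec F x = (\<Sum>i\<in>UNIV. mpeval (multiplier L F $ i) x *\<^sub>R mpeval_vec (mpgrad (g $ i)) x)
       \<and> (\<forall>i\<in>\<E>. mpeval (g $ i) x = 0)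
       \<and> (\<forall>i\<in>\<I>. mpeval (multiplier L F $ i) x \<ge> 0 \<and> mpeval (g $ i) x \<ge> 0
             \<and> mpeval (multiplier L F $ i) x * mpeval (g $ i) x = 0)}"


section \<open>The quadratic objective\<close>

text \<open>\<open>[x]\<^sub>1 = (1, x\<^sub>1, \<dots>, x\<^sub>n)\<close>, where the coordinate \<open>None\<close> holds the leading 1.\<close>

definition homog :: "real ^ 'n \<Rightarrow> real ^ ('n option)" where
  "homog x = (\<chi> i. case i of None \<Rightarrow> 1 | Some k \<Rightarrow> x $ k)"

definition quad_obj :: "real ^ ('n::finite option) ^ ('n option) \<Rightarrow> real ^ 'n \<Rightarrow> real" where
  "quad_obj \<Theta> x = homog x \<bullet> (\<Theta> *v homog x)"

instance uprod :: (finite) finite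
  by standard simp

text \<open>Genericity of a symmetric matrix refers to Lebesgue measure on the space of symmetric
  matrices, of dimension \<open>k (k + 1) / 2\<close>. Its coordinates are the entries at the unordered pairs of
  indices (diagonal included).\<close>

definition sym_matrix :: "real ^ ('k::finite uprod) \<Rightarrow> real ^ 'k ^ 'k" where
  "sym_matrix \<theta> = (\<chi> i j. \<theta> $ Upair i j)"

definition pos_def_matrix :: "real ^ 'k::finite ^ 'k \<Rightarrow> bool" where
  "pos_def_matrix A \<longleftrightarrow> transpose A = A \<and> (\<forall>v. v \<noteq> 0 \<longrightarrow> v \<bullet> (A *v v) > 0)"


section \<open>The algorithms\<close>

text \<open>The feasible set of Step 1 of Algorithm A, which is also the common part of the constraints of
  Algorithm B.\<close>

definition cut_set :: "'v::real_inner set \<Rightarrow> ('v \<Rightarrow> 'v) \<Rightarrow> 'v set \<Rightarrow> 'v set" where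
  "cut_set K F V = {x \<in> K. \<forall>v\<in>V. (v - x) \<bullet> F x \<ge> 0}"

definition Ver_minimizer :: "'v::real_inner set \<Rightarrow> ('v \<Rightarrow> 'v) \<Rightarrow> 'v \<Rightarrow> 'v \<Rightarrow> bool" where
  "Ver_minimizer X F u y \<longleftrightarrow> is_arg_min (\<lambda>y. (y - u) \<bullet> F u) (\<lambda>y. y \<in> X) y"

text \<open>\<open>T\<close> is a nonempty set of minimizers of the verification problem, whose optimal value
  is \<open>\<epsilon>\<close>.\<close>

definition Ver_result ::
    "'v::real_inner set \<Rightarrow> ('v \<Rightarrow> 'v) \<Rightarrow> 'v \<Rightarrow> 'v set \<Rightarrow> real \<Rightarrow> bool" where
  "Ver_result X F u T \<epsilon> \<longleftrightarrow>
     T \<noteq> {} \<and> (\<forall>y\<in>T. Ver_minimizer X F u y \<and> (y - u) \<bullet> F u = \<epsilon>)"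

text \<open>Configurations of the scheme. The prefix tells the algorithm and the step about to be
  executed; \<open>V\<close> is the current set of cuts and \<open>xs\<close> the list of the solutions output so far, in
  the order of their discovery.
    \<^item> \<open>A1 V\<close>: Algorithm A, Step 1;
    \<^item> \<open>A2 V u\<close>: Algorithm A, Steps 2 and 3;
    \<^item> \<open>B0 V xs\<close>: a run of Algorithm B starts, at Step 0, with \<open>x\<^sup>* = last xs\<close>;
    \<^item> \<open>B1 V xs \<delta> \<rho>\<close>: Algorithm B, Step 1;
    \<^item> \<open>B2 V xs \<delta> \<rho> \<gamma>\<close>: Algorithm B, Step 2;
    \<^item> \<open>B3 V xs \<delta>\<close>: Algorithm B, Step 3;
    \<^item> \<open>B4 V xs \<delta> u\<close>: Algorithm B, Steps 4 and 5;
    \<^item> \<open>Finished xs\<close>: Algorithm A has concluded that there is no solution, or Algorithm B that there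
      is no other solution.\<close>

datatype 'v config =
    A1 "'v set"
  | A2 "'v set" 'v
  | B0 "'v set" "'v list"
  | B1 "'v set" "'v list" real real
  | B2 "'v set" "'v list" real real real
  | B3 "'v set" "'v list" real
  | B4 "'v set" "'v list" real 'v
  | Finished "'v list"

text \<open>One step of the scheme, for the objective \<open>q\<close>. The relation is nondeterministic in the choices
  that the algorithms leave open: the minimizer in Step 1 of A and Step 3 of B, the sets \<open>T\<close>, and the
  parameters \<open>\<delta>\<^sub>0\<close> and \<open>\<rho>\<close>. A configuration whose subproblem is feasible but has no
  optimizer has no successor.\<close>

inductive scheme_step ::
    "'v::real_inner set \<Rightarrow> 'v set \<Rightarrow> ('v \<Rightarrow> 'v) \<Rightarrow> ('v \<Rightarrow> real) \<Rightarrow> 'v config \<Rightarrow> 'v config \<Rightarrow> bool"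
  for X K :: "'v set" and F :: "'v \<Rightarrow> 'v" and q :: "'v \<Rightarrow> real" where
  A1_infeasible:
    "cut_set K F V = {} \<Longrightarrow> scheme_step X K F q (A1 V) (Finished [])"
| A1_minimize:
    "is_arg_min q (\<lambda>x. x \<in> cut_set K F V) u \<Longrightarrow> scheme_step X K F q (A1 V) (A2 V u)"
| A2_solution:
    "Ver_result X F u T \<epsilon> \<Longrightarrow> \<epsilon> = 0 \<Longrightarrow> scheme_step X K F q (A2 V u) (B0 V [u])"
| A2_cut:
    "Ver_result X F u T \<epsilon> \<Longrightarrow> \<epsilon> \<noteq> 0 \<Longrightarrow> scheme_step X K F q (A2 V u) (A1 (V \<union> T))"
| B0_start:
    "\<delta>\<^sub>0 > 0 \<Longrightarrow> 0 < \<rho> \<Longrightarrow> \<rho> < 1 \<Longrightarrow> scheme_step X K F q (B0 V xs) (B1 V xs \<delta>\<^sub>0 \<rho>)"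
| B1_maximize:
    "is_arg_max q (\<lambda>x. x \<in> cut_set K F V \<and> q x \<le> q (last xs) + \<delta>) z \<Longrightarrow> \<gamma> = q z \<Longrightarrow>
     scheme_step X K F q (B1 V xs \<delta> \<rho>) (B2 V xs \<delta> \<rho> \<gamma>)"
| B2_accept:
    "\<gamma> = q (last xs) \<Longrightarrow> scheme_step X K F q (B2 V xs \<delta> \<rho> \<gamma>) (B3 V xs \<delta>)"
| B2_shrink:
    "\<gamma> \<noteq> q (last xs) \<Longrightarrow> scheme_step X K F q (B2 V xs \<delta> \<rho> \<gamma>) (B1 V xs (\<rho> * \<delta>) \<rho>)"
| B3_infeasible:
    "\<not> (\<exists>x. x \<in> cut_set K F V \<and> q x \<ge> q (last xs) + \<delta>) \<Longrightarrow>
     scheme_step X K F q (B3 V xs \<delta>) (Finished xs)"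
| B3_minimize:
    "is_arg_min q (\<lambda>x. x \<in> cut_set K F V \<and> q x \<ge> q (last xs) + \<delta>) u \<Longrightarrow>
     scheme_step X K F q (B3 V xs \<delta>) (B4 V xs \<delta> u)"
| B4_solution:
    "Ver_result X F u T \<epsilon> \<Longrightarrow> \<epsilon> = 0 \<Longrightarrow> scheme_step X K F q (B4 V xs \<delta> u) (B0 V (xs @ [u]))"
| B4_cut:
    "Ver_result X F u T \<epsilon> \<Longrightarrow> \<epsilon> \<noteq> 0 \<Longrightarrow> scheme_step X K F q (B4 V xs \<delta> u) (B3 (V \<union> T) xs \<delta>)"

text \<open>Runs go on for as long as a step is possible; a configuration without successor is repeated
  forever.\<close>

definition scheme_run ::
    "'v::real_inner set \<Rightarrow> 'v set \<Rightarrow> ('v \<Rightarrow> 'v) \<Rightarrow> ('v \<Rightarrow> real) \<Rightarrow> (nat \<Rightarrow> 'v config) \<Rightarrow> bool" where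
  "scheme_run X K F q s \<longleftrightarrow>
     s 0 = A1 {} \<and>
     (\<forall>k. scheme_step X K F q (s k) (s (Suc k)) \<or>
          (\<not> (\<exists>c. scheme_step X K F q (s k) c) \<and> s (Suc k) = s k))"

text \<open>Every verification problem met along the run \<open>s\<close> has a minimizer.\<close>

definition Ver_solvable_along ::
    "'v::real_inner set \<Rightarrow> ('v \<Rightarrow> 'v) \<Rightarrow> (nat \<Rightarrow> 'v config) \<Rightarrow> bool" where
  "Ver_solvable_along X F s \<longleftrightarrow>
     (\<forall>k u. ((\<exists>V. s k = A2 V u) \<or> (\<exists>V xs \<delta>. s k = B4 V xs \<delta> u)) \<longrightarrow> (\<exists>y. Ver_minimizer X F u y))"

end

theory Submission
  imports Defs
begin

text \<open>The solutions of the variational inequality are listed in the order of the objective \<open>q\<close>, and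
they all lie in the finite set \<open>K\<close>. Three facts make this work.

Genericity. For almost every symmetric matrix, \<open>q\<close> takes different values at different points of
\<open>K\<close> (\<open>AE_inj_on_quad_obj\<close>), because each coincidence of two values confines the matrix to a
hyperplane.

Necessity of the KKT conditions. Every solution belongs to \<open>K\<close> (\<open>VI_SOL_subset_KKT_set\<close>), with the
multipliers prescribed by the polynomials \<open>\<lambda> = L (F, 0)\<close>. Quadratic penalties
(\<open>approximate_multipliers\<close>) yield points near the solution with multipliers that satisfy the KKT
conditions up to a small error. Nonsingularity of the constraints, in the form of the identity
\<open>L G = I\<close>, makes these multipliers converge to \<open>\<lambda>\<close> (\<open>left_inverse_recovers_multipliers\<close>).

Termination and completeness of the scheme (\<open>scheme_run_finds_all\<close>). Cuts are taken at
points of \<open>X\<close>, so they never remove a solution. A candidate that fails the verification is removed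
by the cuts it generates, so only finitely many candidates fail. The width \<open>\<delta>\<close> is shrunk only finitely often,
since the finitely many values of \<open>q\<close> on \<open>K\<close> other than \<open>q (x\<^sup>*)\<close> have a positive distance from
it; when \<open>\<delta>\<close> is accepted, no solution has a value in the half-open interval from \<open>q (x\<^sup>*)\<close>, excluded, to
\<open>q (x\<^sup>*) + \<delta>\<close>. Hence a minimizer beyond \<open>q (x\<^sup>*) + \<delta>\<close> that passes the verification is the solution
with the next larger value, and by injectivity of \<open>q\<close> it is the only one with this value.\<close>

section \<open>Evaluation and derivatives of polynomials\<close>

lemma mpeval_superset:
  assumes "finite S" "Poly_Mapping.keys p \<subseteq> S"
  shows "mpeval p x = (\<Sum>\<alpha>\<in>S. of_real (Poly_Mapping.lookup p \<alpha>)
                         * (\<Prod>i\<in>UNIV. (x $ i) ^ Poly_Mapping.lookup \<alpha> i))"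
  unfolding mpeval_def using assms
  by (intro sum.mono_neutral_left) (auto simp: in_keys_iff)

lemma mpeval_0 [simp]: "mpeval 0 x = 0"
  by (simp add: mpeval_def)

lemma mpeval_add: "mpeval (p + r) x = mpeval p x + mpeval r x"
proof -
  let ?S = "Poly_Mapping.keys p \<union> Poly_Mapping.keys r"
  show ?thesis
    using keys_add[of p r]
    by (simp add: mpeval_superset[of ?S] lookup_add sum.distrib distrib_right)
qed

lemma mpeval_sum: "mpeval (\<Sum>a\<in>A. f a) x = (\<Sum>a\<in>A. mpeval (f a) x)"
  by (induction A rule: infinite_finite_induct) (auto simp: mpeval_add)

lemma mpeval_single:
  "mpeval (Poly_Mapping.single \<alpha> c) x = of_real c * (\<Prod>i\<in>UNIV. (x $ i) ^ Poly_Mapping.lookup \<alpha> i)"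
  by (simp add: mpeval_superset[of "{\<alpha>}"])

lemma mpeval_1 [simp]: "mpeval 1 x = 1"
  using mpeval_single[of 0 1 x] by simp

lemma sum_single_lookup:
  "(\<Sum>\<alpha>\<in>Poly_Mapping.keys p. Poly_Mapping.single \<alpha> (Poly_Mapping.lookup p \<alpha>)) = p"
proof (rule poly_mapping_eqI)
  fix \<beta>
  show "Poly_Mapping.lookup (\<Sum>\<alpha>\<in>Poly_Mapping.keys p. Poly_Mapping.single \<alpha> (Poly_Mapping.lookup p \<alpha>)) \<beta>
      = Poly_Mapping.lookup p \<beta>"
    by (simp add: lookup_sum lookup_single when_def in_keys_iff)
qed

lemma mpeval_mult: "mpeval (p * r) x = mpeval p x * mpeval r x"
proof -
  let ?m = "\<lambda>p \<alpha>. Poly_Mapping.single \<alpha> (Poly_Mapping.lookup p \<alpha>)"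
  have single: "mpeval (?m p \<alpha> * ?m r \<beta>) x = mpeval (?m p \<alpha>) x * mpeval (?m r \<beta>) x" for \<alpha> \<beta>
    by (simp add: mult_single mpeval_single lookup_add power_add prod.distrib mult_ac)
  have "p * r = (\<Sum>\<alpha>\<in>Poly_Mapping.keys p. \<Sum>\<beta>\<in>Poly_Mapping.keys r. ?m p \<alpha> * ?m r \<beta>)"
    unfolding sum_product[symmetric] sum_single_lookup ..
  also have "mpeval \<dots> x = mpeval (\<Sum>\<alpha>\<in>Poly_Mapping.keys p. ?m p \<alpha>) x
                        * mpeval (\<Sum>\<beta>\<in>Poly_Mapping.keys r. ?m r \<beta>) x"
    by (simp only: mpeval_sum single sum_product)
  finally show ?thesis
    by (simp only: sum_single_lookup)
qed

text \<open>The truncated exponent \<open>\<alpha> i - 1\<close> is harmless: for \<open>\<alpha> i = 0\<close> the factor \<open>\<alpha> i\<close> kills the term.\<close>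

lemma mpeval_mpderiv:
  fixes x :: "real ^ 'n::finite"
  shows "mpeval (mpderiv i p) x =
    (\<Sum>\<alpha>\<in>Poly_Mapping.keys p. Poly_Mapping.lookup p \<alpha> *
       (real (Poly_Mapping.lookup \<alpha> i) * (x $ i) ^ (Poly_Mapping.lookup \<alpha> i - 1) *
        (\<Prod>j\<in>UNIV - {i}. (x $ j) ^ Poly_Mapping.lookup \<alpha> j)))"
proof -
  have "(\<Prod>j\<in>UNIV. (x $ j) ^ Poly_Mapping.lookup (\<alpha> - Poly_Mapping.single i 1) j) =
        (x $ i) ^ (Poly_Mapping.lookup \<alpha> i - 1) *
        (\<Prod>j\<in>UNIV - {i}. (x $ j) ^ Poly_Mapping.lookup \<alpha> j)" for \<alpha>
    by (subst prod.remove[of _ i]) (auto simp: lookup_minus lookup_single when_def intro!: prod.cong)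
  then show ?thesis
    unfolding mpderiv_def by (simp add: mpeval_sum mpeval_single mult_ac)
qed

lemma has_derivative_mpeval:
  fixes x :: "real ^ 'n::finite"
  shows "(mpeval p has_derivative (\<lambda>d. mpeval_vec (mpgrad p) x \<bullet> d)) (at x)"
proof -
  have coord: "((\<lambda>x. x $ i) has_derivative (\<lambda>d. d $ i)) (at x)" for i
    by (rule bounded_linear_imp_has_derivative) (rule bounded_linear_vec_nth)
  have "((\<lambda>x. \<Sum>\<alpha>\<in>Poly_Mapping.keys p. Poly_Mapping.lookup p \<alpha> *
            (\<Prod>i\<in>UNIV. (x $ i) ^ Poly_Mapping.lookup \<alpha> i))
     has_derivative (\<lambda>d. \<Sum>\<alpha>\<in>Poly_Mapping.keys p. Poly_Mapping.lookup p \<alpha> *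
       (\<Sum>i\<in>UNIV. (of_nat (Poly_Mapping.lookup \<alpha> i) * d $ i * (x $ i) ^ (Poly_Mapping.lookup \<alpha> i - 1)) *
          (\<Prod>j\<in>UNIV - {i}. (x $ j) ^ Poly_Mapping.lookup \<alpha> j)))) (at x)"
    by (intro has_derivative_sum has_derivative_mult_right has_derivative_prod
        has_derivative_power coord)
  moreover have "(\<Sum>\<alpha>\<in>Poly_Mapping.keys p. Poly_Mapping.lookup p \<alpha> *
       (\<Sum>i\<in>UNIV. (of_nat (Poly_Mapping.lookup \<alpha> i) * d $ i * (x $ i) ^ (Poly_Mapping.lookup \<alpha> i - 1)) *
          (\<Prod>j\<in>UNIV - {i}. (x $ j) ^ Poly_Mapping.lookup \<alpha> j)))
     = mpeval_vec (mpgrad p) x \<bullet> d" for d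
  proof -
    have "mpeval_vec (mpgrad p) x \<bullet> d = (\<Sum>i\<in>UNIV. \<Sum>\<alpha>\<in>Poly_Mapping.keys p. Poly_Mapping.lookup p \<alpha> *
       ((of_nat (Poly_Mapping.lookup \<alpha> i) * d $ i * (x $ i) ^ (Poly_Mapping.lookup \<alpha> i - 1)) *
          (\<Prod>j\<in>UNIV - {i}. (x $ j) ^ Poly_Mapping.lookup \<alpha> j)))"
      unfolding inner_vec_def mpeval_vec_def mpgrad_def
      by (simp add: mpeval_mpderiv sum_distrib_left sum_distrib_right mult_ac)
    then show ?thesis
      by (subst (asm) sum.swap) (simp add: sum_distrib_left)
  qed
  ultimately show ?thesis
    by (simp add: mpeval_def[abs_def])
qed

lemma continuous_on_mpeval: "continuous_on S (mpeval p :: real ^ 'n::finite \<Rightarrow> real)"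
  by (rule has_derivative_continuous_on[OF has_derivative_at_withinI[OF has_derivative_mpeval]])

section \<open>Approximate multipliers from quadratic penalties\<close>

lemma has_real_derivative_min_0_squared:
  "((\<lambda>t. (min t 0)\<^sup>2) has_real_derivative 2 * min t 0) (at (t::real))"
proof -
  consider "t < 0" | "t > 0" | "t = 0" by linarith
  then show ?thesis
  proof cases
    case 1
    have "((\<lambda>t. t\<^sup>2) has_real_derivative 2 * min t 0) (at t)"
      using 1 by (auto intro!: derivative_eq_intros)
    then show ?thesis
      by (rule has_field_derivative_transform_within_open[where S = "{..<0}"]) (use 1 in auto)
  next
    case 2
    have "((\<lambda>t. 0) has_real_derivative 2 * min t 0) (at t)"
      using 2 by auto
    then show ?thesis
      by (rule has_field_derivative_transform_within_open[where S = "{0<..}"]) (use 2 in auto)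
  next
    case 3
    have "((\<lambda>h::real. (min h 0)\<^sup>2 / h) \<longlongrightarrow> 0) (at 0)"
    proof (rule Lim_null_comparison)
      show "((\<lambda>h::real. \<bar>h\<bar>) \<longlongrightarrow> 0) (at 0)"
        by (rule tendsto_rabs_zero) simp
      show "\<forall>\<^sub>F h::real in at 0. norm ((min h 0)\<^sup>2 / h) \<le> \<bar>h\<bar>"
        by (intro always_eventually allI) (simp add: min_def power2_eq_square)
    qed
    then show ?thesis using 3 by (simp add: DERIV_def)
  qed
qed

text \<open>Suppose that \<open>a\<close> minimizes \<open>c \<bullet> (y - a)\<close> over the feasible set. The minimizers over a ball of
\<open>c \<bullet> (y - a) + (y - a) \<bullet> (y - a) / 2 + (p / 2) * (\<Sum>i\<in>UNIV. (r i (g i y))\<^sup>2)\<close>, where \<open>r i t\<close> is the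
signed amount by which a value \<open>t\<close> of \<open>g i\<close> violates the constraint \<open>i\<close>, converge to \<open>a\<close> for
suitable weights \<open>p\<close> tending to infinity: the penalty forces a limit point to be feasible, and the
quadratic term singles out \<open>a\<close> among the feasible points with the same value of \<open>c \<bullet> (y - a)\<close>. Once
a minimizer \<open>z\<close> is in the interior of the ball, the gradient vanishes there, and this is the
stationarity condition for the multipliers \<open>- p * r i (g i z)\<close>. Their products with \<open>g i z\<close> are, up
to the sign, twice the penalty terms, and these tend to 0 because the penalized objective at \<open>z\<close>
does not exceed its value 0 at \<open>a\<close>. The multipliers themselves may be unbounded.\<close>

proposition approximate_multipliers:
  fixes g :: "'m::finite \<Rightarrow> 'v::euclidean_space \<Rightarrow> real" and Dg :: "'m \<Rightarrow> 'v \<Rightarrow> 'v"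
  assumes Dg: "\<And>i y. (g i has_derivative (\<lambda>d. Dg i y \<bullet> d)) (at y)"
    and UNIV: "\<E> \<union> \<I> = UNIV" and disj: "\<E> \<inter> \<I> = {}"
    and a: "\<forall>i\<in>\<I>. g i a \<ge> 0" "\<forall>i\<in>\<E>. g i a = 0"
    and min: "\<And>y. \<forall>i\<in>\<I>. g i y \<ge> 0 \<Longrightarrow> \<forall>i\<in>\<E>. g i y = 0 \<Longrightarrow> c \<bullet> (y - a) \<ge> 0"
  obtains z :: "nat \<Rightarrow> 'v" and \<mu> :: "nat \<Rightarrow> 'm \<Rightarrow> real"
  where "z \<longlonglongrightarrow> a"
    and "\<forall>\<^sub>F k in sequentially. c + (z k - a) = (\<Sum>i\<in>UNIV. \<mu> k i *\<^sub>R Dg i (z k))"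
    and "\<And>i. (\<lambda>k. \<mu> k i * g i (z k)) \<longlonglongrightarrow> 0"
    and "\<And>i k. i \<in> \<I> \<Longrightarrow> \<mu> k i \<ge> 0"
proof -
  define r where "r = (\<lambda>i t::real. if i \<in> \<E> then t else min t 0)"
  define h where "h = (\<lambda>y. \<Sum>i\<in>UNIV. (r i (g i y))\<^sup>2)"
  define f where "f = (\<lambda>y. c \<bullet> (y - a) + (y - a) \<bullet> (y - a) / 2)"
  have r_mult: "r i t * t = (r i t)\<^sup>2" for i t
    by (simp add: r_def min_def power2_eq_square)
  have feasible_if: "(\<forall>i\<in>\<I>. g i y \<ge> 0) \<and> (\<forall>i\<in>\<E>. g i y = 0)" if "h y = 0" for y
  proof -
    have "r i (g i y) = 0" for i
      using that unfolding h_def by (simp add: sum_nonneg_eq_0_iff)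
    then show ?thesis using disj unfolding r_def min_def
      by (metis disjoint_iff linear)
  qed
  have h_a: "h a = 0"
  proof -
    have "r i (g i a) = 0" for i
    proof -
      have "i \<in> \<E> \<or> i \<in> \<I>" using UNIV by blast
      then show ?thesis using a by (auto simp: r_def min_def intro: antisym)
    qed
    then show ?thesis by (simp add: h_def)
  qed
  have h_nonneg: "h y \<ge> 0" for y unfolding h_def by (intro sum_nonneg) auto
  have deriv_r: "((\<lambda>t. (r i t)\<^sup>2) has_real_derivative 2 * r i t) (at t)" for i t
    using has_real_derivative_min_0_squared[of t] unfolding r_def
    by (cases "i \<in> \<E>") (auto intro!: derivative_eq_intros)
  have deriv_h: "(h has_derivative (\<lambda>d. (\<Sum>i\<in>UNIV. (2 * r i (g i y)) *\<^sub>R Dg i y) \<bullet> d)) (at y)" for y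
  proof -
    have "((\<lambda>y. (r i (g i y))\<^sup>2) has_derivative (\<lambda>d. (Dg i y \<bullet> d) * (2 * r i (g i y)))) (at y)" for i
      using has_derivative_compose[OF Dg deriv_r[unfolded has_field_derivative_def]]
      by (simp add: mult.commute)
    then have "(h has_derivative (\<lambda>d. \<Sum>i\<in>UNIV. (Dg i y \<bullet> d) * (2 * r i (g i y)))) (at y)"
      unfolding h_def by (intro has_derivative_sum)
    then show ?thesis by (simp add: inner_sum_left mult_ac)
  qed
  have deriv_f: "(f has_derivative (\<lambda>d. (c + (y - a)) \<bullet> d)) (at y)" for y
    unfolding f_def
    by (auto intro!: derivative_eq_intros simp: inner_add_left inner_add_right inner_commute)
  have cont_h: "continuous_on S h" and cont_f: "continuous_on S f" for S
    by (rule has_derivative_continuous_on[OF has_derivative_at_withinI[OF deriv_h]],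
        rule has_derivative_continuous_on[OF has_derivative_at_withinI[OF deriv_f]])
  have f_a: "f a = 0" by (simp add: f_def)
  have "\<exists>y\<in>cball a 1. \<forall>w\<in>cball a 1. f y + real k / 2 * h y \<le> f w + real k / 2 * h w" for k
    by (intro continuous_attains_inf continuous_intros cont_f cont_h) auto
  then obtain y where y: "\<And>k. y k \<in> cball a 1"
    and y_min: "\<And>k w. w \<in> cball a 1 \<Longrightarrow> f (y k) + real k / 2 * h (y k) \<le> f w + real k / 2 * h w"
    by metis
  obtain b \<sigma> where \<sigma>: "strict_mono (\<sigma> :: nat \<Rightarrow> nat)" and lim: "(y \<circ> \<sigma>) \<longlonglongrightarrow> b"
    using compact_imp_seq_compact[OF compact_cball, of a 1] y
    unfolding seq_compact_def by metis
  \<comment> \<open>Along the subsequence the penalty weight is the original index.\<close>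
  define z where "z = y \<circ> \<sigma>"
  define p where "p = (\<lambda>k. real (\<sigma> k))"
  have p_top: "filterlim p at_top sequentially"
    unfolding p_def by (intro filterlim_compose[OF filterlim_real_sequentially] filterlim_subseq \<sigma>)
  have p_nonneg: "p k \<ge> 0" for k by (simp add: p_def)
  have z_min: "f (z k) + p k / 2 * h (z k) \<le> f w + p k / 2 * h w" if "w \<in> cball a 1" for k w
    using y_min[OF that] by (simp add: z_def p_def)
  have penalty_le: "p k / 2 * h (z k) \<le> - f (z k)" for k
    using z_min[of a k] f_a h_a by simp
  have lim_f: "(\<lambda>k. f (z k)) \<longlonglongrightarrow> f b" and lim_h: "(\<lambda>k. h (z k)) \<longlonglongrightarrow> h b"
    using continuous_on_tendsto_compose[OF cont_f[of UNIV] lim[folded z_def]]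
      continuous_on_tendsto_compose[OF cont_h[of UNIV] lim[folded z_def]] by simp_all
  have "h b \<le> 0"
  proof (rule LIMSEQ_le[OF lim_h])
    show "(\<lambda>k. 2 * (- f (z k)) / p k) \<longlonglongrightarrow> 0"
      by (rule real_tendsto_divide_at_top[OF tendsto_mult_left[OF tendsto_minus[OF lim_f]] p_top])
    have "\<forall>\<^sub>F k in sequentially. p k > 0"
      using p_top by (auto simp: filterlim_at_top_dense)
    then show "\<exists>N. \<forall>k\<ge>N. h (z k) \<le> 2 * (- f (z k)) / p k"
      unfolding eventually_sequentially
    proof (elim exE, intro exI allI impI)
      fix N k assume "\<forall>n\<ge>N. p n > 0" "k \<ge> N"
      then have "p k > 0" by blast
      then show "h (z k) \<le> 2 * (- f (z k)) / p k"
        unfolding pos_le_divide_eq[OF \<open>p k > 0\<close>] using penalty_le[of k] by (simp add: mult.commute)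
    qed
  qed
  then have "c \<bullet> (b - a) \<ge> 0"
    using h_nonneg[of b] feasible_if[of b] min[of b] by force
  moreover have "f b \<le> 0"
  proof (rule LIMSEQ_le_const2[OF lim_f])
    show "\<exists>N. \<forall>k\<ge>N. f (z k) \<le> 0"
      using penalty_le h_nonneg p_nonneg by (smt (verit) divide_nonneg_nonneg mult_nonneg_nonneg)
  qed
  ultimately have "(b - a) \<bullet> (b - a) \<le> 0" by (simp add: f_def)
  then have b: "b = a" by (metis inner_ge_zero inner_eq_zero_iff order_antisym right_minus_eq)
  define \<mu> where "\<mu> = (\<lambda>k i. - (p k * r i (g i (z k))))"
  have z_lim: "z \<longlonglongrightarrow> a" using lim b by (simp add: z_def)
  moreover have "\<forall>\<^sub>F k in sequentially. c + (z k - a) = (\<Sum>i\<in>UNIV. \<mu> k i *\<^sub>R Dg i (z k))"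
  proof -
    have "\<forall>\<^sub>F k in sequentially. z k \<in> ball a 1"
      using z_lim by (rule topological_tendstoD) auto
    then show ?thesis
    proof eventually_elim
      case (elim k)
      let ?v = "c + (z k - a) + (p k / 2) *\<^sub>R (\<Sum>i\<in>UNIV. (2 * r i (g i (z k))) *\<^sub>R Dg i (z k))"
      have "((\<lambda>w. f w + p k / 2 * h w) has_derivative (\<lambda>d. ?v \<bullet> d)) (at (z k))"
        by (rule has_derivative_eq_rhs[OF has_derivative_add[OF deriv_f has_derivative_mult_right[OF deriv_h]]])
          (simp add: inner_add_left)
      then have "(\<lambda>d. ?v \<bullet> d) = (\<lambda>d. 0)"
        by (rule differential_zero_maxmin[OF elim open_ball]) (use z_min in auto)
      then have "?v \<bullet> ?v = 0" by metis
      then have "?v = 0" by simp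
      moreover have "(p k / 2) *\<^sub>R (\<Sum>i\<in>UNIV. (2 * r i (g i (z k))) *\<^sub>R Dg i (z k))
          = - (\<Sum>i\<in>UNIV. \<mu> k i *\<^sub>R Dg i (z k))"
        by (simp add: \<mu>_def scaleR_sum_right sum_negf)
      ultimately show ?case by simp
    qed
  qed
  moreover have "(\<lambda>k. \<mu> k i * g i (z k)) \<longlonglongrightarrow> 0" for i
  proof (rule Lim_null_comparison)
    have "(\<lambda>k. 2 * (- f (z k))) \<longlonglongrightarrow> 2 * (- f b)" by (intro tendsto_intros lim_f)
    then show "(\<lambda>k. 2 * (- f (z k))) \<longlonglongrightarrow> 0" using b f_a by simp
    have "norm (\<mu> k i * g i (z k)) \<le> 2 * (- f (z k))" for k
    proof -
      have "norm (\<mu> k i * g i (z k)) = p k * (r i (g i (z k)))\<^sup>2"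
        using r_mult[of i "g i (z k)"] p_nonneg[of k] by (simp add: \<mu>_def mult.assoc abs_mult)
      also have "\<dots> \<le> p k * h (z k)"
        unfolding h_def by (intro mult_left_mono p_nonneg member_le_sum) auto
      finally show ?thesis using penalty_le[of k] by simp
    qed
    then show "\<forall>\<^sub>F k in sequentially. norm (\<mu> k i * g i (z k)) \<le> 2 * (- f (z k))" by simp
  qed
  moreover have "\<mu> k i \<ge> 0" if "i \<in> \<I>" for i k
    using that disj p_nonneg[of k] by (auto simp: \<mu>_def r_def min_def mult_nonneg_nonpos)
  ultimately show thesis by (rule that)
qed

section \<open>Solutions are KKT points\<close>

lemma sum_UNIV_sum:
  fixes f :: "'a::finite + 'b::finite \<Rightarrow> 'c::comm_monoid_add"
  shows "(\<Sum>r\<in>UNIV. f r) = (\<Sum>k\<in>UNIV. f (Inl k)) + (\<Sum>j\<in>UNIV. f (Inr j))"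
  using sum.Plus[of "UNIV :: 'a set" "UNIV :: 'b set" f] by (simp add: UNIV_Plus_UNIV o_def)

text \<open>This is \<open>\<mu> = L (x) (G (x) \<mu>)\<close> with the product \<open>G (x) \<mu>\<close> written out: its upper block is the combination
of gradients, its lower block consists of the products \<open>\<mu>\<^sub>j g\<^sub>j (x)\<close>. Thus multipliers are
continuous functions of the point, of the stationarity residual and of the complementarity
products.\<close>

lemma left_inverse_recovers_multipliers:
  fixes L :: "'n::finite mpoly ^ ('n + 'm::finite) ^ 'm" and x :: "real ^ 'n"
  assumes "L ** G_mat g = mat 1"
  shows "\<mu> i = (\<Sum>k\<in>UNIV. mpeval (L $ i $ Inl k) x * (\<Sum>j\<in>UNIV. \<mu> j *\<^sub>R mpeval_vec (mpgrad (g $ j)) x) $ k)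
             + (\<Sum>j\<in>UNIV. mpeval (L $ i $ Inr j) x * (\<mu> j * mpeval (g $ j) x))"
proof -
  have entry: "(\<Sum>r\<in>UNIV. mpeval (L $ i $ r) x * mpeval (G_mat g $ r $ j) x) = (if i = j then 1 else 0)" for j
  proof -
    have "(\<Sum>r\<in>UNIV. L $ i $ r * G_mat g $ r $ j) = (if i = j then 1 else 0)"
      using arg_cong[OF assms, of "\<lambda>M. M $ i $ j"] by (simp add: matrix_matrix_mult_def mat_def)
    from arg_cong[OF this, of "\<lambda>p. mpeval p x"] show ?thesis
      by (simp add: mpeval_sum mpeval_mult split: if_splits)
  qed
  have "\<mu> i = (\<Sum>j\<in>UNIV. (if i = j then 1 else 0) * \<mu> j)"
    by (simp add: if_distrib[of "\<lambda>t. t * _"] cong: if_cong)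
  also have "\<dots> = (\<Sum>j\<in>UNIV. \<Sum>r\<in>UNIV. mpeval (L $ i $ r) x * (mpeval (G_mat g $ r $ j) x * \<mu> j))"
    by (simp only: entry[symmetric] sum_distrib_right mult.assoc)
  also have "\<dots> = (\<Sum>r\<in>UNIV. mpeval (L $ i $ r) x * (\<Sum>j\<in>UNIV. mpeval (G_mat g $ r $ j) x * \<mu> j))"
    by (subst sum.swap) (simp only: sum_distrib_left)
  also have "\<dots> = (\<Sum>k\<in>UNIV. mpeval (L $ i $ Inl k) x * (\<Sum>j\<in>UNIV. \<mu> j *\<^sub>R mpeval_vec (mpgrad (g $ j)) x) $ k)
             + (\<Sum>j\<in>UNIV. mpeval (L $ i $ Inr j) x * (\<mu> j * mpeval (g $ j) x))"
  proof -
    have "(\<Sum>j\<in>UNIV. mpeval (if k = j then g $ j else 0) x * \<mu> j) = \<mu> k * mpeval (g $ k) x" for k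
      by (simp add: if_distrib[of "\<lambda>p. mpeval p x * _"] cong: if_cong)
    then show ?thesis
      unfolding sum_UNIV_sum by (simp add: G_mat_def mpeval_vec_def mult.commute)
  qed
  finally show ?thesis .
qed

lemma mpeval_multiplier:
  fixes x :: "real ^ 'n::finite"
  shows "mpeval (multiplier L F $ i) x = (\<Sum>k\<in>UNIV. mpeval (L $ i $ Inl k) x * mpeval_vec F x $ k)"
  unfolding multiplier_def matrix_vector_mult_def
  by (simp add: mpeval_sum mpeval_mult sum_UNIV_sum F_hat_def mpeval_vec_def)

text \<open>A solution \<open>x\<close> minimizes the linear function \<open>y \<mapsto> (y - x) \<bullet> F (x)\<close> over \<open>X\<close>, so there are approximate
multipliers \<open>\<mu> k\<close> at points \<open>z k\<close> tending to \<open>x\<close>. The polynomial left inverse \<open>L\<close> expresses \<open>\<mu> k\<close> through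
data that converge, and the limit is \<open>L (x)\<close> applied to \<open>(F (x), 0)\<close>, the value of the multiplier
polynomials at \<open>x\<close>. Stationarity, signs and complementarity pass to the limit.\<close>

proposition VI_SOL_subset_KKT_set:
  fixes g :: "'n::finite mpoly ^ 'm::finite"
  assumes disj: "\<E> \<inter> \<I> = {}" and UNIV: "\<E> \<union> \<I> = UNIV"
    and L: "L ** G_mat g = mat 1"
  shows "VI_SOL (semialg_set \<E> \<I> g) (mpeval_vec F) \<subseteq> KKT_set \<E> \<I> g L F"
proof
  fix x :: "real ^ 'n"
  assume x: "x \<in> VI_SOL (semialg_set \<E> \<I> g) (mpeval_vec F)"
  let ?D = "\<lambda>i y. mpeval_vec (mpgrad (g $ i)) y"
  let ?mult = "\<lambda>i. mpeval (multiplier L F $ i) x"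
  have feas: "\<forall>i\<in>\<I>. mpeval (g $ i) x \<ge> 0" "\<forall>i\<in>\<E>. mpeval (g $ i) x = 0"
    using x by (auto simp: VI_SOL_def semialg_set_def)
  obtain z \<mu> where z: "z \<longlonglongrightarrow> x"
    and stat: "\<forall>\<^sub>F k in sequentially. mpeval_vec F x + (z k - x) = (\<Sum>i\<in>UNIV. \<mu> k i *\<^sub>R ?D i (z k))"
    and compl: "\<And>i. (\<lambda>k. \<mu> k i * mpeval (g $ i) (z k)) \<longlonglongrightarrow> 0"
    and nonneg: "\<And>i k. i \<in> \<I> \<Longrightarrow> \<mu> k i \<ge> 0"
  proof (rule approximate_multipliers[of "\<lambda>i. mpeval (g $ i)" ?D \<E> \<I> x "mpeval_vec F x"])
    show "mpeval_vec F x \<bullet> (y - x) \<ge> 0"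
      if "\<forall>i\<in>\<I>. mpeval (g $ i) y \<ge> 0" "\<forall>i\<in>\<E>. mpeval (g $ i) y = 0" for y
      using that x by (auto simp: VI_SOL_def semialg_set_def inner_commute)
  qed (use has_derivative_mpeval feas disj UNIV in auto)
  have lim: "(\<lambda>k. mpeval p (z k)) \<longlonglongrightarrow> mpeval p x" for p
    using continuous_on_tendsto_compose[OF continuous_on_mpeval[of UNIV p] z] by simp
  have \<mu>_lim: "(\<lambda>k. \<mu> k i) \<longlonglongrightarrow> ?mult i" for i
  proof -
    let ?m = "\<lambda>k. (\<Sum>l\<in>UNIV. mpeval (L $ i $ Inl l) (z k) * (mpeval_vec F x + (z k - x)) $ l)
             + (\<Sum>j\<in>UNIV. mpeval (L $ i $ Inr j) (z k) * (\<mu> k j * mpeval (g $ j) (z k)))"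
    have "?m \<longlonglongrightarrow> (\<Sum>l\<in>UNIV. mpeval (L $ i $ Inl l) x * (mpeval_vec F x + (x - x)) $ l)
             + (\<Sum>j\<in>UNIV. mpeval (L $ i $ Inr j) x * 0)"
      by (intro tendsto_intros lim z compl)
    then have "?m \<longlonglongrightarrow> ?mult i" by (simp add: mpeval_multiplier)
    moreover have "\<forall>\<^sub>F k in sequentially. ?m k = \<mu> k i"
      using stat
    proof eventually_elim
      case (elim k)
      show ?case
        unfolding elim
        by (rule left_inverse_recovers_multipliers[OF L, of "\<mu> k" i "z k", symmetric])
    qed
    ultimately show ?thesis by (rule Lim_transform_eventually)
  qed
  have "mpeval_vec F x = (\<Sum>i\<in>UNIV. ?mult i *\<^sub>R ?D i x)"
  proof (rule LIMSEQ_unique)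
    have D_lim: "(\<lambda>k. ?D i (z k)) \<longlonglongrightarrow> ?D i x" for i
      unfolding mpeval_vec_def by (intro vec_tendstoI) (simp add: lim)
    show "(\<lambda>k. \<Sum>i\<in>UNIV. \<mu> k i *\<^sub>R ?D i (z k)) \<longlonglongrightarrow> (\<Sum>i\<in>UNIV. ?mult i *\<^sub>R ?D i x)"
      by (intro tendsto_intros \<mu>_lim D_lim)
    have "(\<lambda>k. mpeval_vec F x + (z k - x)) \<longlonglongrightarrow> mpeval_vec F x + (x - x)"
      by (intro tendsto_intros z)
    then show "(\<lambda>k. \<Sum>i\<in>UNIV. \<mu> k i *\<^sub>R ?D i (z k)) \<longlonglongrightarrow> mpeval_vec F x"
      using tendsto_cong[OF stat] by simp
  qed
  moreover have "?mult i \<ge> 0" if "i \<in> \<I>" for i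
    using LIMSEQ_le_const[OF \<mu>_lim] nonneg[OF that] by blast
  moreover have "?mult i * mpeval (g $ i) x = 0" for i
    using LIMSEQ_unique[OF tendsto_mult[OF \<mu>_lim lim] compl] by blast
  ultimately show "x \<in> KKT_set \<E> \<I> g L F"
    using feas by (simp add: KKT_set_def)
qed

lemma KKT_set_subset_semialg_set: "KKT_set \<E> \<I> g L F \<subseteq> semialg_set \<E> \<I> g"
  by (auto simp: KKT_set_def semialg_set_def)

section \<open>Generic objectives separate finitely many points\<close>

lemma linear_quad_obj_sym_matrix: "linear (\<lambda>\<theta>. quad_obj (sym_matrix \<theta>) x)"
  by (rule linearI)
    (simp_all add: quad_obj_def sym_matrix_def inner_vec_def matrix_vector_mult_def
      algebra_simps sum.distrib sum_distrib_left)

text \<open>The form whose only nonzero entries couple the leading 1 with the coordinate \<open>k\<close> is \<open>x \<mapsto> 2 x\<^sub>k\<close>.\<close>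

lemma quad_obj_separates:
  fixes x y :: "real ^ 'n::finite"
  assumes "x \<noteq> y"
  obtains \<theta> where "quad_obj (sym_matrix \<theta>) x \<noteq> quad_obj (sym_matrix \<theta>) y"
proof -
  obtain k where k: "x $ k \<noteq> y $ k" using assms by (auto simp: vec_eq_iff)
  let ?\<theta> = "axis (Upair None (Some k)) 1 :: real ^ ('n option uprod)"
  have sym: "sym_matrix ?\<theta> *v v = axis None (v $ Some k) + axis (Some k) (v $ None)" for v
    by (auto simp: vec_eq_iff sym_matrix_def matrix_vector_mult_def axis_def UNIV_option_conv
        sum.reindex if_distrib[of "\<lambda>t. t * _"] cong: if_cong)
  have "quad_obj (sym_matrix ?\<theta>) v = 2 * v $ k" for v :: "real ^ 'n"
    unfolding quad_obj_def sym by (simp add: inner_add_right inner_axis homog_def)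
  with k show thesis by (intro that[of ?\<theta>]) simp
qed

text \<open>For two distinct points the difference of the objective values is a nonzero linear function of the
entries of the matrix, so it vanishes only on a hyperplane. Finitely many pairs give a null set.\<close>

proposition AE_inj_on_quad_obj:
  fixes K :: "(real ^ 'n::finite) set"
  assumes "finite K"
  shows "AE \<theta> in lebesgue. inj_on (quad_obj (sym_matrix \<theta>)) K"
proof -
  have "AE \<theta> in lebesgue. quad_obj (sym_matrix \<theta>) x \<noteq> quad_obj (sym_matrix \<theta>) y"
    if neq: "x \<noteq> y" for x y :: "real ^ 'n"
  proof -
    let ?f = "\<lambda>\<theta>. quad_obj (sym_matrix \<theta>) x - quad_obj (sym_matrix \<theta>) y"
    have lin: "linear ?f" by (intro linear_compose_sub linear_quad_obj_sym_matrix)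
    then have f: "?f \<theta> = adjoint ?f 1 \<bullet> \<theta>" for \<theta>
      using adjoint_works[OF lin, of \<theta> 1] by (simp add: inner_commute)
    obtain \<theta>\<^sub>0 where "?f \<theta>\<^sub>0 \<noteq> 0" using quad_obj_separates[OF neq] by auto
    then have "adjoint ?f 1 \<noteq> 0" using f by (metis inner_zero_left)
    then have "negligible {\<theta>. adjoint ?f 1 \<bullet> \<theta> = 0}" by (intro negligible_hyperplane) simp
    then have "AE \<theta> in lebesgue. \<theta> \<notin> {\<theta>. adjoint ?f 1 \<bullet> \<theta> = 0}"
      by (intro AE_not_in) (simp add: negligible_iff_null_sets)
    then show ?thesis by (simp add: f[symmetric])
  qed
  then have "AE \<theta> in lebesgue. \<forall>x\<in>K. \<forall>y\<in>K. x \<noteq> y \<longrightarrow>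
      quad_obj (sym_matrix \<theta>) x \<noteq> quad_obj (sym_matrix \<theta>) y"
    using assms by (intro AE_finite_allI) auto
  then show ?thesis by eventually_elim (auto simp: inj_on_def)
qed

section \<open>Termination and completeness of the scheme\<close>

lemma VI_SOL_subset_cut_set:
  assumes "VI_SOL X F \<subseteq> K" "V \<subseteq> X"
  shows "VI_SOL X F \<subseteq> cut_set K F V"
  using assms unfolding VI_SOL_def cut_set_def by blast

lemma Ver_result_0_imp_VI_SOL:
  assumes "Ver_result X F u T 0" "u \<in> X"
  shows "u \<in> VI_SOL X F"
  using assms unfolding Ver_result_def Ver_minimizer_def is_arg_min_def VI_SOL_def
  by (auto simp: not_less)

text \<open>Comparing with \<open>y = u\<close> shows \<open>\<epsilon> \<le> 0\<close>, so \<open>\<epsilon> < 0\<close>, and every minimizer that is added violates its own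
cut at \<open>u\<close>. At least one is added, because \<open>T\<close> is nonempty.\<close>

lemma Ver_result_cuts_off:
  assumes "Ver_result X F u T \<epsilon>" "\<epsilon> \<noteq> 0" "u \<in> X"
  shows "u \<notin> cut_set K F (V \<union> T)"
proof -
  obtain y where y: "y \<in> T" "Ver_minimizer X F u y" "(y - u) \<bullet> F u = \<epsilon>"
    using assms(1) unfolding Ver_result_def by blast
  have "\<epsilon> \<le> (u - u) \<bullet> F u"
    using y(2,3) assms(3) unfolding Ver_minimizer_def is_arg_min_def by (auto simp: not_less)
  with assms(2) y show ?thesis
    unfolding cut_set_def by force
qed

lemma Ver_result_subset: "Ver_result X F u T \<epsilon> \<Longrightarrow> T \<subseteq> X"
  unfolding Ver_result_def Ver_minimizer_def is_arg_min_def by blast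

lemma ex_is_arg_min_on_finite:
  fixes f :: "'a \<Rightarrow> real"
  assumes "finite {x. P x}" "P a"
  shows "\<exists>x. is_arg_min f P x"
  using ex_is_arg_min_if_finite[of "{x. P x}" f] assms by auto

lemma ex_is_arg_max_on_finite:
  fixes f :: "'a \<Rightarrow> real"
  assumes "finite {x. P x}" "P a"
  shows "\<exists>x. is_arg_max f P x"
  using ex_is_arg_min_on_finite[OF assms, of "\<lambda>x. - f x"]
  by (simp add: is_arg_min_def is_arg_max_def)

text \<open>The algorithms see the variational inequality only through a finite set \<open>K\<close> of candidates between
the solution set and \<open>X\<close>, on which the objective separates points. Nothing polynomial enters their
analysis.\<close>

locale finite_candidates =
  fixes X K :: "'v::real_inner set" and F :: "'v \<Rightarrow> 'v" and q :: "'v \<Rightarrow> real"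
  assumes finite_K: "finite K"
    and K_subset: "K \<subseteq> X"
    and SOL_subset: "VI_SOL X F \<subseteq> K"
    and inj_q: "inj_on q K"
begin

text \<open>Solutions are found in the order of increasing objective value, and this records the progress: none
with a value up to that of the latest one is missing from the list.\<close>

definition enumerates_below :: "'v list \<Rightarrow> bool" where
  "enumerates_below xs \<longleftrightarrow>
     xs \<noteq> [] \<and> set xs \<subseteq> VI_SOL X F \<and> (\<forall>x\<in>VI_SOL X F. q x \<le> q (last xs) \<longrightarrow> x \<in> set xs)"

text \<open>What Step 1 of Algorithm B certifies when \<open>\<delta>\<close> is accepted. The gap concerns solutions and not all
points of the cut set: in this form it does not depend on \<open>V\<close>, so it survives the addition of
cuts.\<close>

definition gap_above :: "'v list \<Rightarrow> real \<Rightarrow> bool" where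
  "gap_above xs \<delta> \<longleftrightarrow> (\<forall>x\<in>VI_SOL X F. \<not> (q (last xs) < q x \<and> q x \<le> q (last xs) + \<delta>))"

fun config_inv :: "'v config \<Rightarrow> bool" where
  "config_inv (A1 V) \<longleftrightarrow> V \<subseteq> X"
| "config_inv (A2 V u) \<longleftrightarrow> V \<subseteq> X \<and> is_arg_min q (\<lambda>x. x \<in> cut_set K F V) u"
| "config_inv (B0 V xs) \<longleftrightarrow> V \<subseteq> X \<and> enumerates_below xs"
| "config_inv (B1 V xs \<delta> \<rho>) \<longleftrightarrow>
     V \<subseteq> X \<and> enumerates_below xs \<and> \<delta> > 0 \<and> 0 < \<rho> \<and> \<rho> < 1"
| "config_inv (B2 V xs \<delta> \<rho> \<gamma>) \<longleftrightarrow>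
     V \<subseteq> X \<and> enumerates_below xs \<and> \<delta> > 0 \<and> 0 < \<rho> \<and> \<rho> < 1
     \<and> (\<exists>z. is_arg_max q (\<lambda>x. x \<in> cut_set K F V \<and> q x \<le> q (last xs) + \<delta>) z \<and> \<gamma> = q z)"
| "config_inv (B3 V xs \<delta>) \<longleftrightarrow> V \<subseteq> X \<and> enumerates_below xs \<and> \<delta> > 0 \<and> gap_above xs \<delta>"
| "config_inv (B4 V xs \<delta> u) \<longleftrightarrow> V \<subseteq> X \<and> enumerates_below xs \<and> \<delta> > 0 \<and> gap_above xs \<delta>
     \<and> is_arg_min q (\<lambda>x. x \<in> cut_set K F V \<and> q x \<ge> q (last xs) + \<delta>) u"
| "config_inv (Finished xs) \<longleftrightarrow> set xs = VI_SOL X F"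

lemma cut_set_subset: "cut_set K F V \<subseteq> K"
  unfolding cut_set_def by blast

lemma SOL_subset_cut_set: "V \<subseteq> X \<Longrightarrow> VI_SOL X F \<subseteq> cut_set K F V"
  using VI_SOL_subset_cut_set SOL_subset by blast

lemma last_in_SOL: "enumerates_below xs \<Longrightarrow> last xs \<in> VI_SOL X F"
  unfolding enumerates_below_def by auto

text \<open>Cuts never remove solutions, so a solution that minimizes \<open>q\<close> on the cut set also minimizes \<open>q\<close> on
the solution set; as \<open>q\<close> is injective, it is the only one with its value or less.\<close>

lemma enumerates_below_singleton:
  assumes "V \<subseteq> X" "is_arg_min q (\<lambda>x. x \<in> cut_set K F V) u" "u \<in> VI_SOL X F"
  shows "enumerates_below [u]"
proof -
  have "x = u" if "x \<in> VI_SOL X F" "q x \<le> q u" for x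
  proof -
    have "q u \<le> q x"
      using assms(2) SOL_subset_cut_set[OF assms(1)] that(1) unfolding is_arg_min_def
      by (meson linorder_not_less subsetD)
    then show ?thesis using that assms(3) inj_q SOL_subset
      by (metis inj_onD order_antisym subsetD)
  qed
  then show ?thesis using assms(3) unfolding enumerates_below_def by auto
qed

text \<open>A solution with a value larger than the latest one exceeds it by at least \<open>\<delta>\<close>, by the gap, so it
was feasible when \<open>u\<close> was chosen. Hence \<open>u\<close> is the next solution in the order of \<open>q\<close>, and
injectivity excludes a second one with the same value.\<close>

lemma enumerates_below_snoc:
  assumes "V \<subseteq> X" "enumerates_below xs" "gap_above xs \<delta>" "u \<in> VI_SOL X F"
    and u: "is_arg_min q (\<lambda>x. x \<in> cut_set K F V \<and> q x \<ge> q (last xs) + \<delta>) u"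
  shows "enumerates_below (xs @ [u])"
proof -
  have "x \<in> set xs \<union> {u}" if x: "x \<in> VI_SOL X F" "q x \<le> q u" for x
  proof (cases "q x \<le> q (last xs)")
    case True
    then show ?thesis using assms(2) x(1) unfolding enumerates_below_def by blast
  next
    case False
    then have "q x \<ge> q (last xs) + \<delta>"
      using assms(3) x(1) unfolding gap_above_def by force
    then have "q u \<le> q x"
      using u SOL_subset_cut_set[OF assms(1)] x(1) unfolding is_arg_min_def
      by (meson linorder_not_less subsetD)
    then show ?thesis using x assms(4) inj_q SOL_subset
      by (metis UnI2 inj_onD order_antisym singletonI subsetD)
  qed
  then show ?thesis using assms(2,4) unfolding enumerates_below_def by auto
qed

lemma maximum_eq_imp_gap_above:
  assumes "V \<subseteq> X"
    and z: "is_arg_max q (\<lambda>x. x \<in> cut_set K F V \<and> q x \<le> q (last xs) + \<delta>) z"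
    and "q z = q (last xs)"
  shows "gap_above xs \<delta>"
  using assms SOL_subset_cut_set[OF assms(1)] unfolding gap_above_def is_arg_max_def by auto

lemma config_inv_step:
  assumes "scheme_step X K F q c c'" "config_inv c"
  shows "config_inv c'"
  using assms
proof (induction rule: scheme_step.induct)
  case (A1_infeasible V)
  then show ?case using SOL_subset_cut_set by auto
next
  case (A2_solution u T \<epsilon> V)
  then have "u \<in> VI_SOL X F"
    using Ver_result_0_imp_VI_SOL cut_set_subset K_subset by (fastforce simp: is_arg_min_def)
  with A2_solution enumerates_below_singleton show ?case by auto
next
  case (A2_cut u T \<epsilon> V)
  then show ?case using Ver_result_subset by fastforce
next
  case (B2_accept \<gamma> xs V \<delta> \<rho>)
  then show ?case using maximum_eq_imp_gap_above by auto
next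
  case (B3_infeasible V xs \<delta>)
  then have V: "V \<subseteq> X" and xs: "enumerates_below xs" and gap: "gap_above xs \<delta>" by auto
  have "q x \<le> q (last xs)" if "x \<in> VI_SOL X F" for x
    using that B3_infeasible(1) SOL_subset_cut_set[OF V] gap unfolding gap_above_def
    by (meson linorder_not_le nle_le subsetD)
  with xs show ?case unfolding enumerates_below_def by auto
next
  case (B4_solution u T \<epsilon> V xs \<delta>)
  then have "u \<in> VI_SOL X F"
    using Ver_result_0_imp_VI_SOL cut_set_subset K_subset by (fastforce simp: is_arg_min_def)
  with B4_solution enumerates_below_snoc show ?case by auto
next
  case (B4_cut u T \<epsilon> V xs \<delta>)
  then show ?case using Ver_result_subset by fastforce
qed auto

text \<open>Every subproblem over \<open>K\<close> has an optimizer once it is feasible, because \<open>K\<close> is finite, and in Step 1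
of Algorithm B the latest solution is feasible. So only a verification problem without a minimizer
could block the scheme.\<close>

lemma scheme_progress:
  assumes inv: "config_inv c" and "\<And>xs. c \<noteq> Finished xs"
    and Ver: "\<And>V xs \<delta> u. c = A2 V u \<or> c = B4 V xs \<delta> u \<Longrightarrow> \<exists>y. Ver_minimizer X F u y"
  shows "\<exists>c'. scheme_step X K F q c c'"
proof (cases c)
  case (A1 V)
  show ?thesis
  proof (cases "cut_set K F V = {}")
    case True
    then show ?thesis using A1 A1_infeasible by blast
  next
    case False
    then obtain a where "a \<in> cut_set K F V" by blast
    moreover have "finite {x. x \<in> cut_set K F V}"
      using finite_subset[OF cut_set_subset finite_K] by simp
    ultimately obtain u where "is_arg_min q (\<lambda>x. x \<in> cut_set K F V) u"
      using ex_is_arg_min_on_finite by metis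
    then show ?thesis using A1 A1_minimize by blast
  qed
next
  case (A2 V u)
  then obtain y where "Ver_minimizer X F u y" using Ver by blast
  then have "Ver_result X F u {y} ((y - u) \<bullet> F u)" unfolding Ver_result_def by simp
  then show ?thesis using A2 A2_solution A2_cut by metis
next
  case (B0 V xs)
  then show ?thesis using B0_start[of 1 "1/2"] by fastforce
next
  case (B1 V xs \<delta> \<rho>)
  let ?P = "\<lambda>x. x \<in> cut_set K F V \<and> q x \<le> q (last xs) + \<delta>"
  have "finite {x. ?P x}"
    using finite_K cut_set_subset by (rule_tac finite_subset[of _ K]) auto
  moreover have "?P (last xs)"
    using inv B1 last_in_SOL SOL_subset_cut_set by auto
  ultimately obtain z where "is_arg_max q ?P z"
    using ex_is_arg_max_on_finite[of ?P "last xs" q] by blast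
  then show ?thesis using B1 B1_maximize by blast
next
  case (B2 V xs \<delta> \<rho> \<gamma>)
  show ?thesis
  proof (cases "\<gamma> = q (last xs)")
    case True
    then show ?thesis by (metis B2 scheme_step.B2_accept)
  next
    case False
    then show ?thesis by (metis B2 scheme_step.B2_shrink)
  qed
next
  case (B3 V xs \<delta>)
  let ?P = "\<lambda>x. x \<in> cut_set K F V \<and> q x \<ge> q (last xs) + \<delta>"
  have fin: "finite {x. ?P x}"
    using finite_K cut_set_subset by (rule_tac finite_subset[of _ K]) auto
  show ?thesis
  proof (cases "\<exists>x. ?P x")
    case True
    then obtain u where "is_arg_min q ?P u"
      using ex_is_arg_min_on_finite[OF fin] by blast
    then show ?thesis using B3 B3_minimize by blast
  next
    case False
    then show ?thesis using B3 B3_infeasible by blast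
  qed
next
  case (B4 V xs \<delta> u)
  then obtain y where "Ver_minimizer X F u y" using Ver by blast
  then have "Ver_result X F u {y} ((y - u) \<bullet> F u)" unfolding Ver_result_def by simp
  then show ?thesis using B4 B4_solution B4_cut by metis
qed (use assms(2) in auto)

text \<open>An upper bound for the number of shrinkings of \<open>\<delta>\<close> still to come: once no point of \<open>K\<close> has a
value in the window, Step 1 of Algorithm B cannot find one in the cut set.\<close>

definition shrinks_left :: "'v list \<Rightarrow> real \<Rightarrow> real \<Rightarrow> nat" where
  "shrinks_left xs \<delta> \<rho> =
     (LEAST n. \<forall>x\<in>K. \<not> (q (last xs) < q x \<and> q x \<le> q (last xs) + \<rho> ^ n * \<delta>))"

text \<open>Each failed verification lowers the first summand and each new solution lowers the second one, while
no step raises either of them.\<close>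

definition remaining :: "'v set \<Rightarrow> 'v list \<Rightarrow> nat" where
  "remaining V xs = card (cut_set K F V) + card {x \<in> K. q (last xs) < q x}"

text \<open>Lexicographically: first the candidates and solutions that remain, then the position within the current
pass through the steps, then the shrinkings. The loop between Steps 1 and 2 of Algorithm B stays at
position 2, and its two half turns are told apart by the parity of the last component. During
Algorithm A the whole of \<open>K\<close> and one more point stand in for the points above the latest solution,
so that also the first solution causes a descent.\<close>

fun rank_of :: "'v config \<Rightarrow> nat \<times> nat \<times> nat" where
  "rank_of (A1 V) = (card (cut_set K F V) + Suc (card K), 1, 0)"
| "rank_of (A2 V u) = (card (cut_set K F V) + Suc (card K), 0, 0)"
| "rank_of (B0 V xs) = (remaining V xs, 3, 0)"
| "rank_of (B1 V xs \<delta> \<rho>) = (remaining V xs, 2, 2 * shrinks_left xs \<delta> \<rho> + 1)"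
| "rank_of (B2 V xs \<delta> \<rho> \<gamma>) = (remaining V xs, 2, 2 * shrinks_left xs \<delta> \<rho>)"
| "rank_of (B3 V xs \<delta>) = (remaining V xs, 1, 0)"
| "rank_of (B4 V xs \<delta> u) = (remaining V xs, 0, 0)"
| "rank_of (Finished xs) = (0, 0, 0)"

text \<open>The finitely many values of \<open>q\<close> on \<open>K\<close> other than \<open>q (last xs)\<close> keep a positive distance from it, which the
geometric sequence \<open>\<rho> ^ n * \<delta>\<close> eventually undercuts. So the least number in the definition is
attained, and it is not 0 as long as \<open>z\<close> lies in the window.\<close>

lemma shrinks_left_decreases:
  assumes \<delta>: "\<delta> > 0" and \<rho>: "0 < \<rho>" "\<rho> < 1"
    and z: "z \<in> K" "q (last xs) < q z" "q z \<le> q (last xs) + \<delta>"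
  shows "shrinks_left xs \<delta> \<rho> = Suc (shrinks_left xs (\<rho> * \<delta>) \<rho>)"
proof -
  let ?P = "\<lambda>n. \<forall>x\<in>K. \<not> (q (last xs) < q x \<and> q x \<le> q (last xs) + \<rho> ^ n * \<delta>)"
  obtain d where d: "d > 0" "\<And>x. x \<in> K \<Longrightarrow> q x \<noteq> q (last xs) \<Longrightarrow> d \<le> dist (q (last xs)) (q x)"
    using finite_set_avoid[of "q ` K" "q (last xs)"] finite_K by blast
  obtain n where "\<rho> ^ n < d / \<delta>"
    using real_arch_pow_inv[of "d / \<delta>" \<rho>] d(1) \<delta> \<rho> by auto
  then have "\<rho> ^ n * \<delta> < d" using \<delta> by (simp add: field_simps)
  then have "?P n" using d(2) by (fastforce simp: dist_real_def)
  moreover have "\<not> ?P 0" using z by auto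
  ultimately have "(LEAST n. ?P n) = Suc (LEAST n. ?P (Suc n))"
    by (rule Least_Suc)
  then show ?thesis
    unfolding shrinks_left_def by (simp add: mult_ac)
qed

lemma card_cut_set_less:
  assumes "Ver_result X F u T \<epsilon>" "\<epsilon> \<noteq> 0" "u \<in> cut_set K F V"
  shows "card (cut_set K F (V \<union> T)) < card (cut_set K F V)"
proof (rule psubset_card_mono)
  show "finite (cut_set K F V)" using finite_K cut_set_subset finite_subset by blast
  have "u \<in> X" using assms(3) cut_set_subset K_subset by blast
  then have "u \<notin> cut_set K F (V \<union> T)" using Ver_result_cuts_off assms by blast
  then show "cut_set K F (V \<union> T) \<subset> cut_set K F V"
    using assms(3) unfolding cut_set_def by blast
qed

lemma rank_of_decreases:
  assumes "scheme_step X K F q c c'" "config_inv c"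
  shows "(rank_of c', rank_of c) \<in> less_than <*lex*> less_than <*lex*> less_than"
  using assms
proof (induction rule: scheme_step.induct)
  case (A2_solution u T \<epsilon> V)
  have "card {x \<in> K. q u < q x} \<le> card K" by (rule card_mono) (use finite_K in auto)
  then show ?case by (auto simp: remaining_def)
next
  case (A2_cut u T \<epsilon> V)
  then show ?case using card_cut_set_less by (auto simp: is_arg_min_def)
next
  case (B2_shrink \<gamma> xs V \<delta> \<rho>)
  then obtain z where V: "V \<subseteq> X" and xs: "enumerates_below xs" and \<delta>: "\<delta> > 0"
    and z: "is_arg_max q (\<lambda>x. x \<in> cut_set K F V \<and> q x \<le> q (last xs) + \<delta>) z" "\<gamma> = q z"
    by auto
  have "q (last xs) \<le> q z"
    using z(1) last_in_SOL[OF xs] SOL_subset_cut_set[OF V] \<delta> unfolding is_arg_max_def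
    by (smt (verit) subsetD)
  with B2_shrink z have "shrinks_left xs \<delta> \<rho> = Suc (shrinks_left xs (\<rho> * \<delta>) \<rho>)"
    using cut_set_subset by (intro shrinks_left_decreases[of _ _ z]) (auto simp: is_arg_max_def)
  then show ?case by simp
next
  case (B4_solution u T \<epsilon> V xs \<delta>)
  then have u: "u \<in> K" "q (last xs) < q u"
    using cut_set_subset by (auto simp: is_arg_min_def)
  have "card {x \<in> K. q u < q x} < card {x \<in> K. q (last xs) < q x}"
    using finite_K u by (intro psubset_card_mono) auto
  then show ?case by (auto simp: remaining_def)
next
  case (B4_cut u T \<epsilon> V xs \<delta>)
  then have "card (cut_set K F (V \<union> T)) < card (cut_set K F V)"
    by (intro card_cut_set_less) (auto simp: is_arg_min_def)
  then show ?case by (simp add: remaining_def)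
qed auto

text \<open>By the invariant, a run that stops has listed all solutions; by the descent of the rank, a run that
never got blocked would have to stop.\<close>

theorem scheme_run_finds_all:
  assumes run: "scheme_run X K F q s" and Ver: "Ver_solvable_along X F s"
  shows "\<exists>N xs. s N = Finished xs \<and> set xs = VI_SOL X F"
proof -
  have inv: "config_inv (s k)" for k
  proof (induction k)
    case 0
    then show ?case using run by (simp add: scheme_run_def)
  next
    case (Suc k)
    then show ?case using run config_inv_step unfolding scheme_run_def by metis
  qed
  have "\<exists>N xs. s N = Finished xs"
  proof (rule ccontr)
    assume *: "\<not> (\<exists>N xs. s N = Finished xs)"
    have "scheme_step X K F q (s k) (s (Suc k))" for k
    proof -
      have "\<exists>c'. scheme_step X K F q (s k) c'"
      proof (rule scheme_progress[OF inv])
        show "s k \<noteq> Finished xs" for xs using * by metis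
        show "\<exists>y. Ver_minimizer X F u y" if "s k = A2 V u \<or> s k = B4 V xs \<delta> u" for V xs \<delta> u
          using that Ver unfolding Ver_solvable_along_def by metis
      qed
      then show ?thesis using run unfolding scheme_run_def by metis
    qed
    then have desc: "(rank_of (s (Suc k)), rank_of (s k)) \<in> less_than <*lex*> less_than <*lex*> less_than"
      for k by (rule rank_of_decreases[OF _ inv])
    have "wf (less_than <*lex*> less_than <*lex*> less_than)"
      by (intro wf_lex_prod wf_less_than)
    then obtain k where "(rank_of (s (Suc k)), rank_of (s k)) \<notin> less_than <*lex*> less_than <*lex*> less_than"
      by (rule wf_no_infinite_down_chainE)
    with desc show False by metis
  qed
  then show ?thesis using inv config_inv.simps(8) by metis
qed

end

section \<open>Generically all solutions are found\<close>

theorem theorem3p7: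
  fixes F :: "'n::finite mpoly ^ 'n"
    and g :: "'n mpoly ^ 'm::finite"
    and \<E> \<I> :: "'m set"
    and L :: "'n mpoly ^ ('n + 'm) ^ 'm"
    and X K :: "(real ^ 'n) set"
  assumes "\<E> \<inter> \<I> = {}" and "\<E> \<union> \<I> = UNIV"
    and X_def: "X = semialg_set \<E> \<I> g"
    and "X \<noteq> {}"
    and "nonsingular_tuple g"
    and "L ** G_mat g = mat 1"
    and K_def: "K = KKT_set \<E> \<I> g L F"
    and "finite K"
  shows "AE \<theta> in lebesgue. pos_def_matrix (sym_matrix \<theta>) \<longrightarrow>
           (\<forall>s. scheme_run X K (mpeval_vec F) (quad_obj (sym_matrix \<theta>)) s
                \<and> Ver_solvable_along X (mpeval_vec F) s \<longrightarrow>
              (\<exists>N xs. s N = Finished xs \<and> set xs = VI_SOL X (mpeval_vec F)))"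
proof -
  have "AE \<theta> in lebesgue. inj_on (quad_obj (sym_matrix \<theta>)) K"
    using \<open>finite K\<close> by (rule AE_inj_on_quad_obj)
  then show ?thesis
  proof eventually_elim
    case (elim \<theta>)
    interpret finite_candidates X K "mpeval_vec F" "quad_obj (sym_matrix \<theta>)"
    proof
      show "K \<subseteq> X"
        unfolding K_def X_def by (rule KKT_set_subset_semialg_set)
      show "VI_SOL X (mpeval_vec F) \<subseteq> K"
        unfolding K_def X_def using assms(1,2,6) by (rule VI_SOL_subset_KKT_set)
    qed (use \<open>finite K\<close> elim in auto)
    show ?case using scheme_run_finds_all by blast
  qed
qed

end
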